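(* Let $d=2$ and $t\neq\frac{t_0+t_1}{2}$, and let $m_t,\tau_t,a_t$ and the probability density $J_t$ on $\mathbb{R}^2$ be as defined in the context. Set $$f_k(r,a_t):=\int_0^{2\pi}\cos(\phi)^k\max\big(0,\,r^2+2\|a_t\|r\cos\phi-d\big)\,\mathrm d\phi\qquad\text{for }r\ge0\text{ and }k=0,1,2.$$ Define $$D=\int_0^\infty e^{-\frac{r^2}{2}}\,r\,f_0(r,a_t)\,\mathrm dr,\qquad N_1=\int_0^\infty e^{-\frac{r^2}{2}}\,r^2f_1(r,a_t)\,\mathrm dr,$$ $$N_{11}=\int_0^\infty e^{-\frac{r^2}{2}}\,r^3f_2(r,a_t)\,\mathrm dr,\qquad N_{r^2}=\int_0^\infty e^{-\frac{r^2}{2}}\,r^3f_0(r,a_t)\,\mathrm dr.$$ Then the mean $\mu^J=E[J_t]$ and the covariance matrix $\mathrm{Cov}(J_t)$ of $J_t$ are $$\mu^J=E[J_t]=m_t+\sqrt{\tau_t}\,\frac{N_1}{D}\,\frac{a_t}{\|a_t\|},$$ $$\mathrm{Cov}(J_t)=\tau_t\Big(\frac{2N_{11}-N_{r^2}}{D}-\frac{N_1^2}{D^2}\Big)\frac{a_ta_t^{\mathsf T}}{\|a_t\|^2}+\tau_t\,\frac{N_{r^2}-N_{11}}{D}\,I_d.$$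
   Context: Let $t_0<t_1$, $x_0,x_1\in\mathbb{R}^d$ with $d=2$, $\eta>0$ and $\rho>0$. For $t\in[t_0,t_1]$ set $m_t:=\frac{t_1-t}{t_1-t_0}x_0+\frac{t-t_0}{t_1-t_0}x_1$ and $\tau_t:=\eta^2\frac{(t-t_0)(t_1-t)}{t_1-t_0}+\rho^2$, and let $p_t$ be the density of the Gaussian $\mathcal N(m_t,\tau_tI_d)$ on $\mathbb{R}^d$, where $I_d$ is the identity matrix. For $t\ne\frac{t_0+t_1}{2}$ set $$\xi_t(y):=\frac{\eta^2(t_0+t_1-2t)}{2(t_1-t_0)\tau_t}\Big(\frac{\|y-m_t\|^2}{\tau_t}+2a_t^{\mathsf T}\frac{y-m_t}{\sqrt{\tau_t}}-d\Big),\qquad a_t:=\frac{\sqrt{\tau_t}}{\eta^2(t_0+t_1-2t)}(x_1-x_0),$$ $$J_t:=\frac{\max(0,\xi_t)\,p_t}{\int_{\mathbb{R}^d}\max(0,\xi_t)\,p_t\,\mathrm dy}.$$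
   Formalization: f_k carries the sign s of t_0+t_1-2t inside the maximum, max(0, s(r^2+2‖a_t‖r cos φ - d)); for t before the midpoint this is the printed formula, and after it the printed mean is false whenever x_0≠x_1. *)

theory Defs
  imports "HOL-Probability.Probability"
begin

definition interp_mean :: "real \<Rightarrow> real \<Rightarrow> real^'n \<Rightarrow> real^'n \<Rightarrow> real \<Rightarrow> real^'n" where
  "interp_mean t0 t1 x0 x1 t =
     ((t1 - t) / (t1 - t0)) *\<^sub>R x0 + ((t - t0) / (t1 - t0)) *\<^sub>R x1"

definition interp_var :: "real \<Rightarrow> real \<Rightarrow> real \<Rightarrow> real \<Rightarrow> real \<Rightarrow> real" where
  "interp_var t0 t1 \<eta> \<rho> t = \<eta>\<^sup>2 * ((t - t0) * (t1 - t) / (t1 - t0)) + \<rho>\<^sup>2"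

text \<open>Lebesgue density of the Gaussian with mean \<open>m\<close> and covariance matrix \<open>\<tau> I\<close>;
  the radicand is the determinant of \<open>2 \<pi> \<tau> I\<close>.\<close>

definition gauss_density :: "real^'n \<Rightarrow> real \<Rightarrow> real^'n \<Rightarrow> real" where
  "gauss_density m \<tau> y =
     exp (- (norm (y - m))\<^sup>2 / (2 * \<tau>)) / sqrt ((2 * pi * \<tau>) ^ CARD('n))"

definition interp_density ::
  "real \<Rightarrow> real \<Rightarrow> real^'n \<Rightarrow> real^'n \<Rightarrow> real \<Rightarrow> real \<Rightarrow> real \<Rightarrow> real^'n \<Rightarrow> real" where
  "interp_density t0 t1 x0 x1 \<eta> \<rho> t =
     gauss_density (interp_mean t0 t1 x0 x1 t) (interp_var t0 t1 \<eta> \<rho> t)"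

definition shift_vec ::
  "real \<Rightarrow> real \<Rightarrow> real^'n \<Rightarrow> real^'n \<Rightarrow> real \<Rightarrow> real \<Rightarrow> real \<Rightarrow> real^'n" where
  "shift_vec t0 t1 x0 x1 \<eta> \<rho> t =
     (sqrt (interp_var t0 t1 \<eta> \<rho> t) / (\<eta>\<^sup>2 * (t0 + t1 - 2 * t))) *\<^sub>R (x1 - x0)"

definition rate ::
  "real \<Rightarrow> real \<Rightarrow> real^'n \<Rightarrow> real^'n \<Rightarrow> real \<Rightarrow> real \<Rightarrow> real \<Rightarrow> real^'n \<Rightarrow> real" where
  "rate t0 t1 x0 x1 \<eta> \<rho> t y =
    (let m = interp_mean t0 t1 x0 x1 t;
         \<tau> = interp_var t0 t1 \<eta> \<rho> t;
         a = shift_vec t0 t1 x0 x1 \<eta> \<rho> t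
     in \<eta>\<^sup>2 * (t0 + t1 - 2 * t) / (2 * (t1 - t0) * \<tau>)
        * ((norm (y - m))\<^sup>2 / \<tau> + 2 * (a \<bullet> ((1 / sqrt \<tau>) *\<^sub>R (y - m))) - real CARD('n)))"

definition jump_density ::
  "real \<Rightarrow> real \<Rightarrow> real^'n \<Rightarrow> real^'n \<Rightarrow> real \<Rightarrow> real \<Rightarrow> real \<Rightarrow> real^'n \<Rightarrow> real" where
  "jump_density t0 t1 x0 x1 \<eta> \<rho> t y =
     max 0 (rate t0 t1 x0 x1 \<eta> \<rho> t y) * interp_density t0 t1 x0 x1 \<eta> \<rho> t y
     / (\<integral>z. max 0 (rate t0 t1 x0 x1 \<eta> \<rho> t z) * interp_density t0 t1 x0 x1 \<eta> \<rho> t z \<partial>lborel)"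

definition jump_measure ::
  "real \<Rightarrow> real \<Rightarrow> real^'n \<Rightarrow> real^'n \<Rightarrow> real \<Rightarrow> real \<Rightarrow> real \<Rightarrow> (real^'n) measure" where
  "jump_measure t0 t1 x0 x1 \<eta> \<rho> t =
     density lborel (\<lambda>y. ennreal (jump_density t0 t1 x0 x1 \<eta> \<rho> t y))"

definition mean_vec :: "(real^'n) measure \<Rightarrow> real^'n" where
  "mean_vec M = (\<integral>y. y \<partial>M)"

definition cov_mat :: "(real^'n) measure \<Rightarrow> real^'n^'n" where
  "cov_mat M = (\<chi> i j. \<integral>y. (y $ i - mean_vec M $ i) * (y $ j - mean_vec M $ j) \<partial>M)"

definition outer :: "real^'n \<Rightarrow> real^'n \<Rightarrow> real^'n^'n" where
  "outer u v = (\<chi> i j. u $ i * v $ j)"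

text \<open>
  The sign \<open>s\<close> is meant to be the sign of \<open>t0 + t1 - 2 t\<close>, that is, of the scalar factor in front of
  the bracket in \<^const>\<open>rate\<close>. Taking the positive part of \<^const>\<open>rate\<close> leaves the positive part of
  \<open>s\<close> times the bracket. For times before the midpoint the sign is \<open>1\<close> and can be dropped, see
  \<open>angular_before_midpoint\<close>; after the midpoint the density lives where the bracket is negative, and
  the sign cannot be omitted. The constant \<open>2\<close> is the dimension.
\<close>

definition angular :: "real \<Rightarrow> nat \<Rightarrow> real \<Rightarrow> real^2 \<Rightarrow> real" where
  "angular s k r a =
     (LBINT \<phi>:{0..2 * pi}. cos \<phi> ^ k * max 0 (s * (r\<^sup>2 + 2 * norm a * r * cos \<phi> - 2)))"

lemma angular_before_midpoint:
  assumes "t < (t0 + t1) / 2"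
  shows "angular (sgn (t0 + t1 - 2 * t)) k r a =
    (LBINT \<phi>:{0..2 * pi}. cos \<phi> ^ k * max 0 (r\<^sup>2 + 2 * norm a * r * cos \<phi> - 2))"
proof -
  have "sgn (t0 + t1 - 2 * t) = 1" using assms by (simp add: field_simps)
  then show ?thesis by (simp add: angular_def)
qed

definition radial_D :: "real \<Rightarrow> real^2 \<Rightarrow> real" where
  "radial_D s a = (LBINT r:{0..}. exp (- r\<^sup>2 / 2) * r * angular s 0 r a)"

definition radial_N1 :: "real \<Rightarrow> real^2 \<Rightarrow> real" where
  "radial_N1 s a = (LBINT r:{0..}. exp (- r\<^sup>2 / 2) * r\<^sup>2 * angular s 1 r a)"

definition radial_N11 :: "real \<Rightarrow> real^2 \<Rightarrow> real" where
  "radial_N11 s a = (LBINT r:{0..}. exp (- r\<^sup>2 / 2) * r ^ 3 * angular s 2 r a)"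

definition radial_Nr2 :: "real \<Rightarrow> real^2 \<Rightarrow> real" where
  "radial_Nr2 s a = (LBINT r:{0..}. exp (- r\<^sup>2 / 2) * r ^ 3 * angular s 0 r a)"

end

theory Submission
  imports Defs
begin

text \<open>
  In the standardized coordinate \<open>z = (y - m) / sqrt \<tau>\<close> the jump density no longer depends on
  the data except through \<open>a\<close> and the sign \<open>s\<close>: up to a constant it is
  \<open>jump_weight s a z = exp (- |z|^2 / 2) * max 0 (s * (|z|^2 + 2 * (a \<bullet> z) - 2))\<close>. The scalar in
  front of the bracket of the rate contributes its sign \<open>s\<close> to the positive part and its absolute
  value to the constant, which the normalization cancels. So \<open>J\<close> is the image, under
  \<open>z \<mapsto> m + sqrt \<tau> z\<close>, of the probability measure with density proportional to \<open>jump_weight s a\<close>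
  (\<open>jump_measure_standardized\<close>).

  This weight depends on \<open>z\<close> only through \<open>|z|\<close> and the component of \<open>z\<close> along \<open>a\<close>. Take an
  orthonormal frame \<open>e, perp e\<close> with \<open>e\<close> the direction of \<open>a\<close>, and polar coordinates in that frame
  (\<open>polar_integral\<close>). Then \<open>z \<bullet> e = r cos \<phi>\<close>, and the integrals of \<open>1\<close>, \<open>z \<bullet> e\<close>, \<open>(z \<bullet> e)^2\<close> and
  \<open>|z|^2\<close> against the weight are \<open>D\<close>, \<open>N1\<close>, \<open>N11\<close> and \<open>Nr2\<close>. By the reflection
  \<open>\<phi> \<mapsto> 2 * pi - \<phi>\<close>, moments that are odd in \<open>z \<bullet> perp e\<close> vanish; and \<open>(z \<bullet> perp e)^2\<close> integrates to
  \<open>Nr2 - N11\<close> by Pythagoras (\<open>weight_moments\<close>). Hence the mean points along \<open>e\<close>, the covariance is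
  diagonal in the frame, and \<open>perp e (perp e)^T = I - e e^T\<close> turns it into the stated form.

  If \<open>a = 0\<close>, every direction is as good as any other. The stated formulas then contain
  \<open>a / |a| = 0\<close>, and they are correct because the coefficients \<open>N1\<close> and \<open>2 * N11 - Nr2\<close> are zero by
  rotational symmetry (\<open>radial_zero_shift\<close>).
\<close>

section \<open>Orthonormal frames of the plane\<close>

definition perp :: "real^2 \<Rightarrow> real^2" where
  "perp e = vector [- e$2, e$1]"

definition polar :: "real^2 \<Rightarrow> real \<Rightarrow> real \<Rightarrow> real^2" where
  "polar e r \<phi> = (r * cos \<phi>) *\<^sub>R e + (r * sin \<phi>) *\<^sub>R perp e"

lemma perp_nth [simp]: "perp e $ 1 = - e$2" "perp e $ 2 = e$1"
  by (simp_all add: perp_def)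

lemma inner_real2: "x \<bullet> y = x$1 * y$1 + x$2 * y$2" for x y :: "real^2"
  by (simp add: inner_vec_def sum_2)

lemma unit_real2: "norm e = 1 \<Longrightarrow> (e$1)\<^sup>2 + (e$2)\<^sup>2 = 1" for e :: "real^2"
  by (simp add: norm_eq_1 inner_real2 power2_eq_square)

lemma frame:
  assumes "norm e = 1"
  shows "e \<bullet> e = 1" "perp e \<bullet> perp e = 1" "e \<bullet> perp e = 0" "perp e \<bullet> e = 0"
  using unit_real2[OF assms] by (simp_all add: inner_real2 power2_eq_square algebra_simps)

lemma frame_expansion:
  assumes "norm e = 1"
  shows "(z \<bullet> e) *\<^sub>R e + (z \<bullet> perp e) *\<^sub>R perp e = z"
proof -
  have "z$1 * ((e$1)\<^sup>2 + (e$2)\<^sup>2) = z$1" "z$2 * ((e$1)\<^sup>2 + (e$2)\<^sup>2) = z$2"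
    using unit_real2[OF assms] by simp_all
  then show ?thesis
    by (simp add: vec_eq_iff forall_2 inner_real2 power2_eq_square algebra_simps)
qed

lemma polar_inner:
  assumes "norm e = 1"
  shows "polar e r \<phi> \<bullet> e = r * cos \<phi>" "polar e r \<phi> \<bullet> perp e = r * sin \<phi>"
  using frame[OF assms] by (simp_all add: polar_def inner_left_distrib)

lemma norm_frame:
  assumes "norm e = 1"
  shows "(norm z)\<^sup>2 = (z \<bullet> e)\<^sup>2 + (z \<bullet> perp e)\<^sup>2"
proof -
  have "(norm z)\<^sup>2 = z \<bullet> ((z \<bullet> e) *\<^sub>R e + (z \<bullet> perp e) *\<^sub>R perp e)"
    by (simp only: frame_expansion[OF assms] power2_norm_eq_inner)
  then show ?thesis by (simp add: inner_right_distrib power2_eq_square)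
qed

lemma norm_polar: "norm e = 1 \<Longrightarrow> (norm (polar e r \<phi>))\<^sup>2 = r\<^sup>2"
  by (simp add: norm_frame[of e] polar_inner power_mult_distrib flip: distrib_left)

section \<open>Polar coordinates\<close>

lemma measurable_vector2 [measurable]:
  "(\<lambda>(x, y). vector [x, y] :: real^2) \<in> borel_measurable (lborel \<Otimes>\<^sub>M lborel)"
  by (subst borel_measurable_euclidean_space)
    (auto simp: Basis_vec_def inner_axis split_beta exhaust_2 forall_2)

text \<open>
  The transfer that makes Fubini available on the plane: both sides agree on boxes.
\<close>

lemma lborel_real2: "lborel = distr (lborel \<Otimes>\<^sub>M lborel) borel (\<lambda>(x, y). vector [x, y] :: real^2)"
proof (rule lborel_eqI)
  have B: "(Basis :: (real^2) set) = {axis 1 1, axis 2 1}"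
    by (auto simp: Basis_vec_def exhaust_2 UNIV_2)
  fix l u :: "real^2"
  assume le: "\<And>b. b \<in> Basis \<Longrightarrow> l \<bullet> b \<le> u \<bullet> b"
  have "l$1 \<le> u$1" "l$2 \<le> u$2"
    using le[of "axis 1 1"] le[of "axis 2 1"] by (auto simp: inner_axis Basis_vec_def)
  have "(\<lambda>(x, y). vector [x, y] :: real^2) -` box l u = {l$1<..<u$1} \<times> {l$2<..<u$2}"
    by (auto simp: mem_box_cart forall_2)
  then show "emeasure (distr (lborel \<Otimes>\<^sub>M lborel) borel (\<lambda>(x, y). vector [x, y] :: real^2)) (box l u)
      = (\<Prod>b\<in>Basis. (u - l) \<bullet> b)"
    using \<open>l$1 \<le> u$1\<close> \<open>l$2 \<le> u$2\<close>
    by (simp add: B emeasure_distr space_pair_measure lborel.emeasure_pair_measure_Times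
        inner_axis axis_eq_axis ennreal_mult)
qed simp

lemma polar_has_derivative:
  fixes S :: "(real^2) set"
  shows "((\<lambda>x. polar e (x$1) (x$2)) has_derivative
     (\<lambda>h. h$1 *\<^sub>R polar e 1 (x$2) + h$2 *\<^sub>R ((- x$1 * sin (x$2)) *\<^sub>R e + (x$1 * cos (x$2)) *\<^sub>R perp e)))
   (at x within S)"
proof -
  have d [derivative_intros]: "((\<lambda>x. x $ i) has_derivative (\<lambda>h. h $ i)) (at x within S)" for i
    by (rule bounded_linear_imp_has_derivative[OF bounded_linear_vec_nth])
  show ?thesis
    unfolding polar_def
    by (rule derivative_eq_intros refl | simp)+ (simp add: fun_eq_iff algebra_simps)
qed

text \<open>
  The Jacobian is that of ordinary polar coordinates times the determinant \<open>e$1^2 + e$2^2 = 1\<close> of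
  the frame.
\<close>

lemma polar_jacobian:
  assumes "norm e = 1"
  shows "det (matrix (\<lambda>h::real^2. h$1 *\<^sub>R polar e 1 \<phi> + h$2 *\<^sub>R ((- r * sin \<phi>) *\<^sub>R e + (r * cos \<phi>) *\<^sub>R perp e))) = r"
proof -
  have "det (matrix (\<lambda>h::real^2. h$1 *\<^sub>R polar e 1 \<phi>
        + h$2 *\<^sub>R ((- r * sin \<phi>) *\<^sub>R e + (r * cos \<phi>) *\<^sub>R perp e)))
      = r * ((cos \<phi>)\<^sup>2 + (sin \<phi>)\<^sup>2) * ((e$1)\<^sup>2 + (e$2)\<^sup>2)"
    by (simp add: det_2 matrix_def axis_def polar_def power2_eq_square algebra_simps del: sin_cos_squared_add3)
  then show ?thesis
    using unit_real2[OF assms] by simp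
qed

text \<open>
  The boundary angles \<open>0\<close> and \<open>2 * pi\<close> and the radius \<open>0\<close> are left out to make the
  parametrization injective on an open set. The cost is the half line spanned by \<open>e\<close>.
\<close>

definition polar_domain :: "(real^2) set" where
  "polar_domain = {x. 0 < x$1 \<and> 0 < x$2 \<and> x$2 < 2 * pi}"

lemma open_polar_domain: "open polar_domain"
  unfolding polar_domain_def by (intro open_Collect_conj open_Collect_less continuous_intros)

lemma polar_inj:
  assumes "norm e = 1"
  shows "inj_on (\<lambda>x. polar e (x$1) (x$2)) polar_domain"
proof (rule inj_onI)
  fix x y assume x: "x \<in> polar_domain" and y: "y \<in> polar_domain"
    and eq: "polar e (x$1) (x$2) = polar e (y$1) (y$2)"
  have "(x$1)\<^sup>2 = (y$1)\<^sup>2" using eq norm_polar[OF assms] by metis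
  then have r: "x$1 = y$1" using x y by (simp add: polar_domain_def)
  have "x$1 * cos (x$2) = y$1 * cos (y$2)" "x$1 * sin (x$2) = y$1 * sin (y$2)"
    using eq polar_inner[OF assms] by metis+
  then have "cos (x$2) = cos (y$2)" "sin (x$2) = sin (y$2)" using r x by (simp_all add: polar_domain_def)
  then have "x$2 = y$2"
  proof -
    obtain n :: int where n: "x$2 = y$2 + 2 * pi * n"
      using \<open>cos (x$2) = cos (y$2)\<close> \<open>sin (x$2) = sin (y$2)\<close> sin_cos_eq_iff by metis
    have "\<bar>x$2 - y$2\<bar> < 2 * pi" using x y by (simp add: polar_domain_def abs_less_iff)
    then have "2 * pi * \<bar>real_of_int n\<bar> < 2 * pi * 1"
      using n by (simp add: abs_mult)
    then have "\<bar>real_of_int n\<bar> < 1"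
      by (subst (asm) mult_less_cancel_left_pos) auto
    then show ?thesis using n by simp
  qed
  with r show "x = y" by (simp add: vec_eq_iff forall_2)
qed

lemma polar_image:
  assumes "norm e = 1" and "z \<bullet> perp e \<noteq> 0"
  shows "z \<in> (\<lambda>x. polar e (x$1) (x$2)) ` polar_domain"
proof -
  let ?u = "z \<bullet> e" and ?v = "z \<bullet> perp e"
  have n: "(norm z)\<^sup>2 = ?u\<^sup>2 + ?v\<^sup>2" by (rule norm_frame[OF assms(1)])
  have p: "norm z > 0" using assms(2) by auto
  have "(?u / norm z)\<^sup>2 + (?v / norm z)\<^sup>2 = (?u\<^sup>2 + ?v\<^sup>2) / (norm z)\<^sup>2"
    by (simp add: power_divide add_divide_distrib)
  also have "\<dots> = 1" using p by (simp flip: n)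
  finally have "(?u / norm z)\<^sup>2 + (?v / norm z)\<^sup>2 = 1" .
  then obtain \<phi> where \<phi>: "0 \<le> \<phi>" "\<phi> < 2 * pi" "?u / norm z = cos \<phi>" "?v / norm z = sin \<phi>"
    using sincos_total_2pi by metis
  have "\<phi> \<noteq> 0" using \<phi> assms(2) p by auto
  have "polar e (norm z) \<phi> = z"
    using \<phi>(3,4) p unfolding polar_def
    by (metis (no_types, lifting) frame_expansion[OF assms(1)] nonzero_mult_div_cancel_left order_less_irrefl times_divide_eq_right)
  moreover have "vector [norm z, \<phi>] \<in> polar_domain" using \<phi> \<open>\<phi> \<noteq> 0\<close> p by (simp add: polar_domain_def)
  ultimately show ?thesis by (intro image_eqI[of _ _ "vector [norm z, \<phi>]"]) simp_all
qed


text \<open>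
  Change of variables. The image of \<open>polar_domain\<close> misses only points of the line orthogonal to
  \<open>perp e\<close>, which is negligible.
\<close>

lemma polar_integral_domain:
  fixes f :: "real^2 \<Rightarrow> real"
  assumes e: "norm e = 1" and f: "integrable lborel f"
  shows "set_integrable lborel polar_domain (\<lambda>x. x$1 * f (polar e (x$1) (x$2)))"
    and "integral\<^sup>L lborel f = (LBINT x:polar_domain. x$1 * f (polar e (x$1) (x$2)))"
proof -
  let ?g = "\<lambda>x::real^2. polar e (x$1) (x$2)" and ?S = polar_domain
  let ?D = "\<lambda>x h. h$1 *\<^sub>R polar e 1 (x$2)
    + h$2 *\<^sub>R ((- x$1 * sin (x$2)) *\<^sub>R e + (x$1 * cos (x$2)) *\<^sub>R perp e)"
  have [measurable]: "f \<in> borel_measurable borel" using f by auto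
  have S [measurable]: "?S \<in> sets borel" using open_polar_domain by simp
  have "perp e \<noteq> 0" using frame(2)[OF e] by auto
  have "negligible {z. perp e \<bullet> z = 0}"
    by (rule negligible_hyperplane) (simp add: \<open>perp e \<noteq> 0\<close>)
  then have neg: "negligible (UNIV - ?g ` ?S)"
    by (rule negligible_subset) (use polar_image[OF e] in \<open>auto simp: inner_commute\<close>)
  have fU: "f absolutely_integrable_on UNIV"
    using f by (simp add: set_integrable_def integrable_completion)
  have fS: "f absolutely_integrable_on ?g ` ?S"
  proof -
    have "negligible {x. x \<notin> ?g ` ?S \<and> f x \<noteq> 0}" by (rule negligible_subset[OF neg]) auto
    then show ?thesis
      using fU absolutely_integrable_spike_set_eq[of UNIV "?g ` ?S" f] by simp
  qed
  \<comment> \<open>change of variables for vector-valued functions, applied to \<open>f\<close> as a function into \<open>real^1\<close>\<close>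
  have cv: "((\<lambda>x. \<bar>det (matrix (?D x))\<bar> *\<^sub>R (vec (f (?g x)) :: real^1)) absolutely_integrable_on ?S \<and>
       integral ?S (\<lambda>x. \<bar>det (matrix (?D x))\<bar> *\<^sub>R (vec (f (?g x)) :: real^1)) = vec b)
     \<longleftrightarrow> ((\<lambda>x. vec (f x) :: real^1) absolutely_integrable_on ?g ` ?S \<and>
       integral (?g ` ?S) (\<lambda>x. vec (f x) :: real^1) = vec b)" for b
    by (rule has_absolute_integral_change_of_variables[where g="?g" and g'="?D", OF _ polar_has_derivative polar_inj[OF e]])
      (use S in simp)
  have "(\<lambda>x. \<bar>x$1\<bar> * f (?g x)) absolutely_integrable_on ?S \<and> 
      integral ?S (\<lambda>x. \<bar>x$1\<bar> * f (?g x)) = integral (?g ` ?S) f"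
    using cv[of "integral (?g ` ?S) f"] fS
    unfolding polar_jacobian[OF e] by (simp add: absolutely_integrable_on_1_iff integral_on_1_eq)
  moreover have "integral UNIV f = integral (?g ` ?S) f"
    by (rule integral_spike_set) (use neg in \<open>auto intro: negligible_subset\<close>)
  moreover have "integral UNIV f = integral\<^sup>L lborel f"
    using f by (simp add: integral_lborel)
  moreover have "set_integrable lebesgue ?S (\<lambda>x. \<bar>x$1\<bar> * f (?g x)) = set_integrable lebesgue ?S (\<lambda>x. x$1 * f (?g x))"
    by (rule set_integrable_cong) (auto simp: polar_domain_def)
  moreover have "integral ?S (\<lambda>x. \<bar>x$1\<bar> * f (?g x)) = integral ?S (\<lambda>x. x$1 * f (?g x))"
    by (rule Henstock_Kurzweil_Integration.integral_cong) (auto simp: polar_domain_def)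
  ultimately have *: "set_integrable lebesgue ?S (\<lambda>x. x$1 * f (?g x))"
    "integral ?S (\<lambda>x. x$1 * f (?g x)) = integral\<^sup>L lborel f" by simp_all
  have m: "(\<lambda>x. x$1 * f (?g x)) \<in> borel_measurable borel"
    unfolding polar_def by measurable
  then show 1: "set_integrable lborel ?S (\<lambda>x. x$1 * f (?g x))"
    using *(1) unfolding set_integrable_def
    by (subst (asm) integrable_completion) simp_all
  show "integral\<^sup>L lborel f = (LBINT x:polar_domain. x$1 * f (polar e (x$1) (x$2)))"
    using set_borel_integral_eq_integral(2)[OF 1] *(2) by simp
qed

lemma polar_integral:
  fixes f :: "real^2 \<Rightarrow> real"
  assumes e: "norm e = 1" and f: "integrable lborel f"
  shows "integral\<^sup>L lborel f = (LBINT r:{0..}. r * (LBINT \<phi>:{0..2*pi}. f (polar e r \<phi>)))"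
proof -
  let ?v = "\<lambda>(x, y). vector [x, y] :: real^2"
  let ?h = "\<lambda>x. indicator polar_domain x *\<^sub>R (x$1 * f (polar e (x$1) (x$2)))"
  let ?k = "\<lambda>r \<phi>. (indicator {0<..} r * indicator {0<..<2*pi} \<phi>) * (r * f (polar e r \<phi>))"
  have [measurable]: "f \<in> borel_measurable borel" using f by auto
  have [measurable]: "polar_domain \<in> sets borel" using open_polar_domain by simp
  have v: "?v \<in> borel_measurable (lborel \<Otimes>\<^sub>M lborel)" by (rule measurable_vector2)
  have h: "integrable lborel ?h" "integral\<^sup>L lborel f = integral\<^sup>L lborel ?h"
    using polar_integral_domain[OF e f] by (simp_all only: set_integrable_def set_lebesgue_integral_def)
  have hm: "?h \<in> borel_measurable borel" using h(1) by auto
  have k: "?h (?v p) = case_prod ?k p" for p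
    by (cases p) (auto simp: polar_domain_def indicator_def)
  have "integrable (distr (lborel \<Otimes>\<^sub>M lborel) borel ?v) ?h"
    using h(1) by (simp flip: lborel_real2)
  then have ki: "integrable (lborel \<Otimes>\<^sub>M lborel) (case_prod ?k)"
    by (subst (asm) integrable_distr_eq[OF v hm]) (simp only: k)
  have "integral\<^sup>L lborel ?h = integral\<^sup>L (distr (lborel \<Otimes>\<^sub>M lborel) borel ?v) ?h"
    by (simp flip: lborel_real2)
  also have "\<dots> = integral\<^sup>L (lborel \<Otimes>\<^sub>M lborel) (case_prod ?k)"
    by (subst integral_distr[OF v hm]) (simp only: k)
  also have "\<dots> = (\<integral>r. (\<integral>\<phi>. ?k r \<phi> \<partial>lborel) \<partial>lborel)"
    by (rule lborel_pair.integral_fst[OF ki, symmetric])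
  also have "\<dots> = (\<integral>r. (\<integral>\<phi>. indicator {0<..} r * r * (indicator {0..2*pi} \<phi> * f (polar e r \<phi>)) \<partial>lborel) \<partial>lborel)"
  proof (rule Bochner_Integration.integral_cong[OF refl], rule integral_cong_AE)
    fix r :: real
    show "AE \<phi> in lborel. ?k r \<phi> = indicator {0<..} r * r * (indicator {0..2*pi} \<phi> * f (polar e r \<phi>))"
      using AE_lborel_singleton[of 0] AE_lborel_singleton[of "2*pi"]
      by eventually_elim (auto simp: indicator_def)
  qed (simp_all add: polar_def)
  also have "\<dots> = (\<integral>r. indicator {0..} r * (r * (\<integral>\<phi>. indicator {0..2*pi} \<phi> * f (polar e r \<phi>) \<partial>lborel)) \<partial>lborel)"
    by (rule Bochner_Integration.integral_cong) (auto simp: indicator_def)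
  finally show ?thesis
    unfolding h(2) set_lebesgue_integral_def by simp
qed

section \<open>Moments of the standardized weight\<close>

lemma integrable_gauss_real2: "integrable lborel (\<lambda>z::real^2. exp (- (norm z)\<^sup>2 / 4))"
proof -
  have "integrable lborel (\<lambda>x. sqrt (2 * pi * (sqrt 2)\<^sup>2) * normal_density 0 (sqrt 2) x)"
    by (intro integrable_mult_right integrable_normal_density) simp
  then have g: "integrable lborel (\<lambda>x::real. exp (- x\<^sup>2 / 4))"
    by (simp add: normal_density_def)
  have n: "(norm (vector [x, y] :: real^2))\<^sup>2 = x\<^sup>2 + y\<^sup>2" for x y :: real
    unfolding power2_norm_eq_inner inner_real2 by (simp add: power2_eq_square)
  have "integrable (lborel \<Otimes>\<^sub>M lborel) (\<lambda>(x::real, y::real). exp (- x\<^sup>2 / 4) * exp (- y\<^sup>2 / 4))"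
    by (rule lborel_pair.Fubini_integrable) (use g in simp_all)
  also have "(\<lambda>(x::real, y::real). exp (- x\<^sup>2 / 4) * exp (- y\<^sup>2 / 4))
      = (\<lambda>p. exp (- (norm (vector [fst p, snd p] :: real^2))\<^sup>2 / 4))"
    by (auto simp: fun_eq_iff n add_divide_distrib simp flip: exp_add)
  finally have "integrable (distr (lborel \<Otimes>\<^sub>M lborel) borel (\<lambda>(x, y). vector [x, y] :: real^2))
      (\<lambda>z. exp (- (norm z)\<^sup>2 / 4))"
    by (subst integrable_distr_eq[OF measurable_vector2]) (simp_all add: split_beta)
  then show ?thesis by (simp flip: lborel_real2)
qed

definition jump_weight :: "real \<Rightarrow> real^2 \<Rightarrow> real^2 \<Rightarrow> real" where
  "jump_weight s a z = exp (- (norm z)\<^sup>2 / 2) * max 0 (s * ((norm z)\<^sup>2 + 2 * (a \<bullet> z) - 2))"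

lemma weight_nonneg: "0 \<le> jump_weight s a z"
  by (simp add: jump_weight_def)

lemma continuous_weight: "continuous_on UNIV (jump_weight s a)"
  unfolding jump_weight_def by (intro continuous_intros) simp

lemma measurable_weight [measurable]: "jump_weight s a \<in> borel_measurable borel"
  by (rule borel_measurable_continuous_onI[OF continuous_weight])

text \<open>
  A dominating function for integrands of quadratic growth. The bracket is also at most a multiple of
  \<open>1 + |z|^2\<close>, and half of the Gaussian exponent pays for the product \<open>(1 + |z|^2)^2\<close>; the constant comes from \<open>x^2 / 2 \<le> exp x\<close> at
  \<open>x = (1 + |z|^2) / 4\<close>.
\<close>

lemma weight_bound:
  assumes "\<bar>s\<bar> \<le> 1"
  shows "jump_weight s a z * (1 + (norm z)\<^sup>2)
    \<le> 32 * exp (1/4) * ((norm a)\<^sup>2 + 2) * exp (- (norm z)\<^sup>2 / 4)"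
proof -
  let ?u = "(norm z)\<^sup>2" and ?b = "(norm z)\<^sup>2 + 2 * (a \<bullet> z) - 2"
  have "0 \<le> (norm (a + z))\<^sup>2" "0 \<le> (norm (a - z))\<^sup>2" by simp_all
  then have "\<bar>2 * (a \<bullet> z)\<bar> \<le> (norm a)\<^sup>2 + ?u"
    by (simp add: power2_norm_eq_inner inner_left_distrib inner_right_distrib inner_diff_left inner_diff_right inner_commute abs_le_iff)
  moreover have "0 \<le> ?u" "0 \<le> (norm a)\<^sup>2 * ?u" by simp_all
  moreover have "((norm a)\<^sup>2 + 2) * (1 + ?u) = (norm a)\<^sup>2 + 2 + (norm a)\<^sup>2 * ?u + 2 * ?u"
    by (simp add: algebra_simps)
  ultimately have b: "\<bar>?b\<bar> \<le> ((norm a)\<^sup>2 + 2) * (1 + ?u)"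
    by linarith
  have "s * ?b \<le> \<bar>s\<bar> * \<bar>?b\<bar>" by (simp flip: abs_mult)
  also have "\<dots> \<le> \<bar>?b\<bar>" using assms by (simp add: mult_left_le_one_le)
  finally have m: "max 0 (s * ?b) \<le> ((norm a)\<^sup>2 + 2) * (1 + ?u)" using b by linarith
  have "((1 + ?u) / 4)\<^sup>2 / 2 \<le> exp ((1 + ?u) / 4)"
  proof -
    have "0 \<le> (1 + ?u) / 4" by simp
    then show ?thesis using exp_lower_Taylor_quadratic[of "(1 + ?u) / 4"] by linarith
  qed
  then have t: "(1 + ?u)\<^sup>2 \<le> 32 * exp ((1 + ?u) / 4)"
    by (simp add: power_divide)
  have "jump_weight s a z * (1 + ?u) \<le> exp (- ?u / 2) * (((norm a)\<^sup>2 + 2) * (1 + ?u)) * (1 + ?u)"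
    unfolding jump_weight_def using m by (intro mult_right_mono mult_left_mono) auto
  also have "\<dots> = exp (- ?u / 2) * ((norm a)\<^sup>2 + 2) * (1 + ?u)\<^sup>2"
    by (simp add: power2_eq_square)
  also have "\<dots> \<le> exp (- ?u / 2) * ((norm a)\<^sup>2 + 2) * (32 * exp ((1 + ?u) / 4))"
    using t by (intro mult_left_mono) auto
  also have "\<dots> = 32 * ((norm a)\<^sup>2 + 2) * (exp (- ?u / 2) * exp ((1 + ?u) / 4))"
    by simp
  also have "exp (- ?u / 2) * exp ((1 + ?u) / 4) = exp (1/4) * exp (- ?u / 4)"
    by (simp add: field_simps flip: exp_add)
  also have "32 * ((norm a)\<^sup>2 + 2) * (exp (1/4) * exp (- ?u / 4))
      = 32 * exp (1/4) * ((norm a)\<^sup>2 + 2) * exp (- ?u / 4)"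
    by (simp only: mult_ac)
  finally show ?thesis .
qed

lemma integrable_weight_mult:
  assumes s: "\<bar>s\<bar> \<le> 1" and [measurable]: "g \<in> borel_measurable borel"
    and g: "\<And>z. \<bar>g z\<bar> \<le> C * (1 + (norm z)\<^sup>2)"
  shows "integrable lborel (\<lambda>z. jump_weight s a z * g z)"
proof (rule Bochner_Integration.integrable_bound)
  show "integrable lborel (\<lambda>z::real^2. C * (32 * exp (1/4) * ((norm a)\<^sup>2 + 2)) * exp (- (norm z)\<^sup>2 / 4))"
    by (rule integrable_mult_right) (rule integrable_gauss_real2)
  have "C \<ge> 0" using g[of 0] by simp
  have "\<bar>jump_weight s a z * g z\<bar> \<le> \<bar>C * (32 * exp (1/4) * ((norm a)\<^sup>2 + 2)) * exp (- (norm z)\<^sup>2 / 4)\<bar>" for z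
  proof -
    have "\<bar>jump_weight s a z * g z\<bar> \<le> jump_weight s a z * (C * (1 + (norm z)\<^sup>2))"
      using mult_left_mono[OF g weight_nonneg] by (simp add: abs_mult weight_nonneg)
    also have "\<dots> = C * (jump_weight s a z * (1 + (norm z)\<^sup>2))" by simp
    also have "\<dots> \<le> C * (32 * exp (1/4) * ((norm a)\<^sup>2 + 2) * exp (- (norm z)\<^sup>2 / 4))"
      using weight_bound[OF s] \<open>C \<ge> 0\<close> by (rule mult_left_mono)
    finally show ?thesis by simp
  qed
  then show "AE z in lborel. norm (jump_weight s a z * g z)
      \<le> norm (C * (32 * exp (1/4) * ((norm a)\<^sup>2 + 2)) * exp (- (norm z)\<^sup>2 / 4))"
    by simp
qed simp

text \<open>
  The weight is continuous and nonnegative, so it suffices that it is positive somewhere: far from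
  the origin for \<open>s = 1\<close>, where \<open>|z|^2\<close> dominates, and at the origin for \<open>s = -1\<close>, where the bracket
  is \<open>-2\<close>.
\<close>

lemma integral_weight_pos:
  assumes s: "\<bar>s\<bar> = 1"
  shows "0 < integral\<^sup>L lborel (jump_weight s a)"
proof -
  have int: "integrable lborel (jump_weight s a)"
    using integrable_weight_mult[of s "\<lambda>_. 1" 1 a] s by simp
  have "integral\<^sup>L lborel (jump_weight s a) \<noteq> 0"
  proof
    assume "integral\<^sup>L lborel (jump_weight s a) = 0"
    then have "AE z in lborel. jump_weight s a z = 0"
      using int weight_nonneg by (subst (asm) integral_nonneg_eq_0_iff_AE) auto
    then have "{z. jump_weight s a z \<noteq> 0} \<in> null_sets lborel"
      by (subst (asm) AE_iff_null) simp_all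
    then have "negligible {z. jump_weight s a z \<noteq> 0}"
      by (simp add: negligible_iff_null_sets null_sets_completionI)
    moreover have "open {z. jump_weight s a z \<noteq> 0}"
      by (intro open_Collect_neq continuous_weight continuous_intros)
    ultimately have w0: "jump_weight s a z = 0" for z
      using open_not_negligible by blast
    consider "s = 1" | "s = -1" using s by linarith
    then show False
    proof cases
      case 1
      let ?z = "(2 + 2 * norm a) *\<^sub>R axis 1 1 :: real^2"
      have n: "norm ?z = 2 + 2 * norm a" by simp
      have "\<bar>a \<bullet> ?z\<bar> \<le> norm a * (2 + 2 * norm a)"
        using Cauchy_Schwarz_ineq2[of a ?z] by (simp only: n)
      moreover have eq: "(2 + 2 * norm a)\<^sup>2 - 2 * (norm a * (2 + 2 * norm a)) - 2 = 2 + 4 * norm a"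
        by (simp add: power2_eq_square algebra_simps)
      ultimately have "(2 + 2 * norm a)\<^sup>2 + 2 * (a \<bullet> ?z) - 2 > 0"
        using eq norm_ge_zero[of a] by linarith
      then have "jump_weight s a ?z > 0" unfolding jump_weight_def n 1 by simp
      then show False using w0 by simp
    next
      case 2
      then show False using w0[of 0] by (simp add: jump_weight_def)
    qed
  qed
  moreover have "0 \<le> integral\<^sup>L lborel (jump_weight s a)" by (simp add: weight_nonneg)
  ultimately show ?thesis by linarith
qed

lemma weight_polar:
  assumes "norm e = 1" and "a = norm a *\<^sub>R e"
  shows "jump_weight s a (polar e r \<phi>) = exp (- r\<^sup>2 / 2) * max 0 (s * (r\<^sup>2 + 2 * norm a * r * cos \<phi> - 2))"
proof -
  have "a \<bullet> polar e r \<phi> = norm a * (polar e r \<phi> \<bullet> e)"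
    by (subst assms(2)) (simp add: inner_commute)
  then show ?thesis
    by (simp add: jump_weight_def norm_polar[OF assms(1)] polar_inner[OF assms(1)] mult.assoc)
qed

text \<open>
  The inner integral over the angle is \<open>angular\<close> by definition; the extra factor \<open>r\<close> is the
  Jacobian.
\<close>

lemma weight_integral_angular:
  assumes e: "norm e = 1" "a = norm a *\<^sub>R e"
    and int: "integrable lborel (\<lambda>z. jump_weight s a z * g z)"
    and g: "\<And>r \<phi>. g (polar e r \<phi>) = c r * cos \<phi> ^ k"
  shows "has_bochner_integral lborel (\<lambda>z. jump_weight s a z * g z)
    (LBINT r:{0..}. exp (- r\<^sup>2 / 2) * (r * c r) * angular s k r a)"
proof -
  have "(LBINT \<phi>:{0..2*pi}. jump_weight s a (polar e r \<phi>) * g (polar e r \<phi>))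
      = exp (- r\<^sup>2 / 2) * c r * angular s k r a" for r
    unfolding angular_def set_integral_mult_right[symmetric] g weight_polar[OF e]
    by (simp add: mult_ac)
  note angular = this
  show ?thesis
    using int unfolding has_bochner_integral_iff polar_integral[OF e(1) int] angular
    by (simp add: mult_ac)
qed

text \<open>
  The substitution \<open>\<phi> \<mapsto> 2 * pi - \<phi>\<close> changes the sign of the integrand.
\<close>

lemma integral_sin_cos_period_eq_0:
  "(LBINT \<phi>:{0..2*pi}. sin \<phi> * F (cos \<phi>)) = (0::real)"
proof -
  let ?f = "\<lambda>\<phi>. indicator {0..2*pi} \<phi> * (sin \<phi> * F (cos \<phi>))"
  have odd: "?f (2 * pi + (-1) * \<phi>) = - ?f \<phi>" for \<phi>
    by (auto simp: indicator_def)
  have "integral\<^sup>L lborel ?f = - integral\<^sup>L lborel ?f"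
    using lborel_integral_real_affine[of "-1" ?f "2 * pi"] unfolding odd by simp
  then show ?thesis by (simp add: set_lebesgue_integral_def)
qed

lemma weight_integral_odd:
  assumes e: "norm e = 1" "a = norm a *\<^sub>R e"
    and int: "integrable lborel (\<lambda>z. jump_weight s a z * g z)"
    and g: "\<And>r \<phi>. g (polar e r \<phi>) = sin \<phi> * c r (cos \<phi>)"
  shows "has_bochner_integral lborel (\<lambda>z. jump_weight s a z * g z) 0"
proof -
  have "(LBINT \<phi>:{0..2*pi}. jump_weight s a (polar e r \<phi>) * g (polar e r \<phi>)) = 0" for r
    using integral_sin_cos_period_eq_0[of "\<lambda>x. exp (- r\<^sup>2 / 2) * max 0 (s * (r\<^sup>2 + 2 * norm a * r * x - 2)) * c r x"]
    unfolding g weight_polar[OF e] by (simp add: mult_ac)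
  then show ?thesis
    using int by (simp add: has_bochner_integral_iff polar_integral[OF e(1) int])
qed

text \<open>
  The first and second moments in the frame adapted to \<open>a\<close>. The hypothesis \<open>a = norm a *\<^sub>R e\<close>
  fixes \<open>e\<close> as the direction of \<open>a\<close>, or leaves it free if \<open>a = 0\<close>.
\<close>

lemma weight_moments:
  assumes e: "norm e = 1" "a = norm a *\<^sub>R e" and s: "\<bar>s\<bar> \<le> 1"
  shows "has_bochner_integral lborel (jump_weight s a) (radial_D s a)"
    and "has_bochner_integral lborel (\<lambda>z. jump_weight s a z * (z \<bullet> e)) (radial_N1 s a)"
    and "has_bochner_integral lborel (\<lambda>z. jump_weight s a z * (z \<bullet> perp e)) 0"
    and "has_bochner_integral lborel (\<lambda>z. jump_weight s a z * (z \<bullet> e)\<^sup>2) (radial_N11 s a)"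
    and "has_bochner_integral lborel (\<lambda>z. jump_weight s a z * ((z \<bullet> e) * (z \<bullet> perp e))) 0"
    and "has_bochner_integral lborel (\<lambda>z. jump_weight s a z * (z \<bullet> perp e)\<^sup>2) (radial_Nr2 s a - radial_N11 s a)"
proof -
  have p: "norm (perp e) = 1" using frame(2)[OF e(1)] by (simp add: norm_eq_1)
  have ce: "\<bar>z \<bullet> e\<bar> \<le> norm z" and cp: "\<bar>z \<bullet> perp e\<bar> \<le> norm z" for z
    using Cauchy_Schwarz_ineq2[of z e] Cauchy_Schwarz_ineq2[of z "perp e"] e(1) p by simp_all
  have nb: "norm z \<le> 1 + (norm z)\<^sup>2" for z :: "real^2"
    using sum_power2_ge_zero[of "norm z - 1" 0] by (simp add: power2_diff) (smt (verit) norm_ge_zero)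
  have 2: "\<bar>x * y\<bar> \<le> (norm z)\<^sup>2" if "\<bar>x\<bar> \<le> norm z" "\<bar>y\<bar> \<le> norm z" for x y and z :: "real^2"
    using mult_mono[OF that] by (simp add: abs_mult power2_eq_square)
  have int: "integrable lborel (\<lambda>z. jump_weight s a z * g z)"
    if "g \<in> borel_measurable borel" "\<And>z. \<bar>g z\<bar> \<le> 1 + (norm z)\<^sup>2" for g
    using integrable_weight_mult[OF s that(1), of 1] that(2) by simp
  have r3: "r ^ 3 = r * r\<^sup>2" for r :: real by (simp add: power3_eq_cube power2_eq_square)
  note [simp] = polar_inner[OF e(1)] norm_polar[OF e(1)]
  have "has_bochner_integral lborel (\<lambda>z. jump_weight s a z * 1)
      (LBINT r:{0..}. exp (- r\<^sup>2 / 2) * (r * 1) * angular s 0 r a)"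
    by (rule weight_integral_angular[OF e int]) auto
  then show "has_bochner_integral lborel (jump_weight s a) (radial_D s a)"
    by (simp add: radial_D_def)
  have "has_bochner_integral lborel (\<lambda>z. jump_weight s a z * (z \<bullet> e))
      (LBINT r:{0..}. exp (- r\<^sup>2 / 2) * (r * r) * angular s 1 r a)"
    by (rule weight_integral_angular[OF e int]) (use ce nb in \<open>auto intro: order_trans\<close>)
  then show "has_bochner_integral lborel (\<lambda>z. jump_weight s a z * (z \<bullet> e)) (radial_N1 s a)"
    by (simp add: radial_N1_def power2_eq_square)
  show "has_bochner_integral lborel (\<lambda>z. jump_weight s a z * (z \<bullet> perp e)) 0"
    by (rule weight_integral_odd[OF e int, where c="\<lambda>r _. r"]) (use cp nb in \<open>auto intro: order_trans\<close>)
  have "has_bochner_integral lborel (\<lambda>z. jump_weight s a z * (z \<bullet> e)\<^sup>2)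
      (LBINT r:{0..}. exp (- r\<^sup>2 / 2) * r ^ 3 * angular s 2 r a)"
    unfolding r3
    by (rule weight_integral_angular[OF e int])
      (use 2[OF ce ce] in \<open>auto simp: power2_eq_square intro: add_increasing\<close>)
  then show N11: "has_bochner_integral lborel (\<lambda>z. jump_weight s a z * (z \<bullet> e)\<^sup>2) (radial_N11 s a)"
    by (simp add: radial_N11_def)
  show "has_bochner_integral lborel (\<lambda>z. jump_weight s a z * ((z \<bullet> e) * (z \<bullet> perp e))) 0"
    by (rule weight_integral_odd[OF e int, where c="\<lambda>r x. r\<^sup>2 * x"])
      (use 2[OF ce cp] in \<open>auto simp: power2_eq_square intro: add_increasing\<close>)
  have "has_bochner_integral lborel (\<lambda>z. jump_weight s a z * (norm z)\<^sup>2)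
      (LBINT r:{0..}. exp (- r\<^sup>2 / 2) * r ^ 3 * angular s 0 r a)"
    unfolding r3 by (rule weight_integral_angular[OF e int]) auto
  then have "has_bochner_integral lborel (\<lambda>z. jump_weight s a z * (norm z)\<^sup>2) (radial_Nr2 s a)"
    by (simp add: radial_Nr2_def)
  from has_bochner_integral_diff[OF this N11]
  show "has_bochner_integral lborel (\<lambda>z. jump_weight s a z * (z \<bullet> perp e)\<^sup>2) (radial_Nr2 s a - radial_N11 s a)"
    by (simp add: norm_frame[OF e(1)] algebra_simps)
qed

text \<open>
  With \<open>a = 0\<close> the positive part in \<open>angular\<close> is independent of the angle, and what remains are the
  means of \<open>cos \<phi>\<close> and of \<open>(cos \<phi>)^2\<close> over a period, \<open>0\<close> and \<open>1 / 2\<close>.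
\<close>

lemma radial_zero_shift:
  "radial_N1 s 0 = 0" "2 * radial_N11 s 0 = radial_Nr2 s 0"
proof -
  have c1: "(LBINT \<phi>:{0..2*pi}. cos \<phi>) = 0"
    using integral_FTC_Icc_real[of 0 "2*pi" sin cos]
    by (simp add: set_lebesgue_integral_def mult.commute)
  have d: "((\<lambda>x. (x + sin x * cos x) / 2) has_real_derivative (cos x)\<^sup>2) (at x)" for x :: real
  proof -
    have "(1 + (cos x * cos x - sin x * sin x)) / 2 = (cos x)\<^sup>2"
      using sin_cos_squared_add[of x] by (simp add: power2_eq_square)
    then show ?thesis by (auto intro!: derivative_eq_intros)
  qed
  have c2: "(LBINT \<phi>:{0..2*pi}. (cos \<phi>)\<^sup>2) = pi"
    using integral_FTC_Icc_real[of 0 "2*pi" "\<lambda>x. (x + sin x * cos x) / 2" "\<lambda>x. (cos x)\<^sup>2"] d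
    by (simp add: set_lebesgue_integral_def mult.commute continuous_intros)
  have "angular s 1 r 0 = 0" for r
    unfolding angular_def by (simp add: c1)
  then show "radial_N1 s 0 = 0" by (simp add: radial_N1_def)
  have a2: "angular s 0 r 0 = 2 * angular s 2 r 0" for r
    unfolding angular_def by (simp add: c2) (simp add: set_lebesgue_integral_def)
  show "2 * radial_N11 s 0 = radial_Nr2 s 0"
    unfolding radial_N11_def radial_Nr2_def a2 
    by (simp add: mult_ac flip: set_integral_mult_right)
qed

section \<open>Standardization of the jump measure\<close>

lemma density_lborel_affine:
  fixes f :: "'a::euclidean_space \<Rightarrow> ennreal"
  assumes [measurable]: "f \<in> borel_measurable borel" and "c \<noteq> 0"
  shows "density lborel f
    = distr (density lborel (\<lambda>z. ennreal (\<bar>c\<bar> ^ DIM('a)) * f (t + c *\<^sub>R z))) borel (\<lambda>z. t + c *\<^sub>R z)"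
proof -
  have "density lborel f
      = density (density (distr lborel borel (\<lambda>z. t + c *\<^sub>R z)) (\<lambda>_. ennreal (\<bar>c\<bar> ^ DIM('a)))) f"
    using lborel_affine[OF \<open>c \<noteq> 0\<close>, of t] by simp
  also have "\<dots> = density (distr lborel borel (\<lambda>z. t + c *\<^sub>R z)) (\<lambda>z. ennreal (\<bar>c\<bar> ^ DIM('a)) * f z)"
    by (rule density_density_eq) simp_all
  also have "\<dots> = distr (density lborel (\<lambda>z. ennreal (\<bar>c\<bar> ^ DIM('a)) * f (t + c *\<^sub>R z))) borel (\<lambda>z. t + c *\<^sub>R z)"
    by (rule density_distr) simp_all
  finally show ?thesis .
qed

lemma integral_lborel_affine:
  fixes f :: "'a::euclidean_space \<Rightarrow> real"
  assumes [measurable]: "f \<in> borel_measurable borel" and "c \<noteq> 0"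
  shows "integral\<^sup>L lborel f = \<bar>c\<bar> ^ DIM('a) * (\<integral>z. f (t + c *\<^sub>R z) \<partial>lborel)"
  by (subst lborel_affine[OF \<open>c \<noteq> 0\<close>, of t])
    (simp add: integral_density integral_distr)

lemma interp_var_pos:
  assumes "t0 < t1" "\<rho> > 0" "t \<in> {t0..t1}"
  shows "0 < interp_var t0 t1 \<eta> \<rho> t"
proof -
  have "0 \<le> \<eta>\<^sup>2 * ((t - t0) * (t1 - t) / (t1 - t0))" using assms by simp
  then show ?thesis using assms(2) unfolding interp_var_def by (simp add: add_nonneg_pos)
qed

lemma rate_standardized:
  fixes x0 x1 z :: "real^2"
  assumes "0 < interp_var t0 t1 \<eta> \<rho> t"
  defines "m \<equiv> interp_mean t0 t1 x0 x1 t" and "\<tau> \<equiv> interp_var t0 t1 \<eta> \<rho> t"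
    and "a \<equiv> shift_vec t0 t1 x0 x1 \<eta> \<rho> t"
  shows "rate t0 t1 x0 x1 \<eta> \<rho> t (m + sqrt \<tau> *\<^sub>R z)
    = \<eta>\<^sup>2 * (t0 + t1 - 2 * t) / (2 * (t1 - t0) * \<tau>) * ((norm z)\<^sup>2 + 2 * (a \<bullet> z) - 2)"
  using assms(1) unfolding rate_def Let_def m_def[symmetric] \<tau>_def[symmetric] a_def[symmetric]
  by (simp add: power_mult_distrib)

text \<open>
  The scalar in front of the bracket of the rate is \<open>s\<close> times its absolute value, and only the
  absolute value can be pulled out of the positive part.
\<close>

lemma jump_numerator_standardized:
  fixes x0 x1 z :: "real^2"
  assumes "t0 < t1" "0 < interp_var t0 t1 \<eta> \<rho> t"
  defines "m \<equiv> interp_mean t0 t1 x0 x1 t" and "\<tau> \<equiv> interp_var t0 t1 \<eta> \<rho> t"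
    and "a \<equiv> shift_vec t0 t1 x0 x1 \<eta> \<rho> t" and "s \<equiv> sgn (t0 + t1 - 2 * t)"
  shows "max 0 (rate t0 t1 x0 x1 \<eta> \<rho> t (m + sqrt \<tau> *\<^sub>R z)) * interp_density t0 t1 x0 x1 \<eta> \<rho> t (m + sqrt \<tau> *\<^sub>R z)
    = \<eta>\<^sup>2 * \<bar>t0 + t1 - 2 * t\<bar> / (2 * (t1 - t0) * \<tau>) / (2 * pi * \<tau>) * jump_weight s a z"
proof -
  have \<tau>: "\<tau> > 0" using assms(2) by (simp add: \<tau>_def)
  let ?K = "\<eta>\<^sup>2 * \<bar>t0 + t1 - 2 * t\<bar> / (2 * (t1 - t0) * \<tau>)"
  let ?b = "(norm z)\<^sup>2 + 2 * (a \<bullet> z) - 2"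
  have K: "?K \<ge> 0" using assms(1) \<tau> by simp
  have "\<eta>\<^sup>2 * (t0 + t1 - 2 * t) / (2 * (t1 - t0) * \<tau>) * ?b = ?K * (s * ?b)"
    unfolding s_def by (subst sgn_mult_abs[of "t0 + t1 - 2 * t", symmetric]) simp
  then have "rate t0 t1 x0 x1 \<eta> \<rho> t (m + sqrt \<tau> *\<^sub>R z) = ?K * (s * ?b)"
    using rate_standardized[OF assms(2), of x0 x1 z] unfolding m_def \<tau>_def a_def by (rule trans[rotated])
  moreover have "max 0 (?K * x) = ?K * max 0 x" for x
    using max_mult_distrib_left[of ?K 0 x] K by simp
  ultimately have r: "max 0 (rate t0 t1 x0 x1 \<eta> \<rho> t (m + sqrt \<tau> *\<^sub>R z)) = ?K * max 0 (s * ?b)"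
    by simp
  have d: "sqrt ((2 * pi * \<tau>) ^ CARD(2)) = 2 * pi * \<tau>"
    using \<tau> by (simp del: power_mult_distrib)
  have "interp_density t0 t1 x0 x1 \<eta> \<rho> t (m + sqrt \<tau> *\<^sub>R z) = exp (- (norm z)\<^sup>2 / 2) / (2 * pi * \<tau>)"
    unfolding interp_density_def m_def[symmetric] \<tau>_def[symmetric] gauss_density_def
    unfolding d using \<tau> by (simp add: power_mult_distrib)
  then show ?thesis unfolding r jump_weight_def by simp
qed

text \<open>
  Substituting \<open>y = m + sqrt \<tau> z\<close> in the normalizing integral and in the measure gives the same
  Jacobian \<open>\<tau>\<close>, so it cancels together with all constants.
\<close>

lemma jump_measure_standardized:
  fixes x0 x1 :: "real^2"
  assumes "t0 < t1" "\<eta> > 0" "0 < interp_var t0 t1 \<eta> \<rho> t" "t \<noteq> (t0 + t1) / 2"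
  defines "m \<equiv> interp_mean t0 t1 x0 x1 t" and "\<tau> \<equiv> interp_var t0 t1 \<eta> \<rho> t"
    and "a \<equiv> shift_vec t0 t1 x0 x1 \<eta> \<rho> t" and "s \<equiv> sgn (t0 + t1 - 2 * t)"
  shows "jump_measure t0 t1 x0 x1 \<eta> \<rho> t
    = distr (density lborel (\<lambda>z. ennreal (jump_weight s a z / integral\<^sup>L lborel (jump_weight s a))))
        borel (\<lambda>z. m + sqrt \<tau> *\<^sub>R z)"
proof -
  have \<tau>: "\<tau> > 0" using assms(3) by (simp add: \<tau>_def)
  define C where "C = \<eta>\<^sup>2 * \<bar>t0 + t1 - 2 * t\<bar> / (2 * (t1 - t0) * \<tau>) / (2 * pi * \<tau>)"
  have C: "C > 0" using assms(1,2,4) \<tau> unfolding C_def by (auto simp: field_simps)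
  let ?q = "\<lambda>y. max 0 (rate t0 t1 x0 x1 \<eta> \<rho> t y) * interp_density t0 t1 x0 x1 \<eta> \<rho> t y"
  have [measurable]: "?q \<in> borel_measurable borel"
    unfolding rate_def Let_def interp_density_def gauss_density_def by measurable
  have q: "?q (m + sqrt \<tau> *\<^sub>R z) = C * jump_weight s a z" for z
    using jump_numerator_standardized[OF assms(1,3)] unfolding C_def m_def \<tau>_def a_def s_def by simp
  let ?D = "integral\<^sup>L lborel (jump_weight s a)"
  have "integral\<^sup>L lborel ?q = (sqrt \<tau>)\<^sup>2 * (\<integral>z. C * jump_weight s a z \<partial>lborel)"
    using \<tau> by (subst integral_lborel_affine[of _ "sqrt \<tau>" m]) (simp_all add: q)
  then have Z: "integral\<^sup>L lborel ?q = \<tau> * C * ?D" using \<tau> by simp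
  have j: "jump_density t0 t1 x0 x1 \<eta> \<rho> t (m + sqrt \<tau> *\<^sub>R z) = jump_weight s a z / (\<tau> * ?D)" for z
    unfolding jump_density_def q Z using C by simp
  have [measurable]: "jump_density t0 t1 x0 x1 \<eta> \<rho> t \<in> borel_measurable borel"
    unfolding jump_density_def by measurable
  have "ennreal (\<bar>sqrt \<tau>\<bar> ^ DIM(real^2)) * ennreal (jump_density t0 t1 x0 x1 \<eta> \<rho> t (m + sqrt \<tau> *\<^sub>R z))
      = ennreal (jump_weight s a z / ?D)" for z
    unfolding j using \<tau> by (subst ennreal_mult'[symmetric]) simp_all
  then show ?thesis
    unfolding jump_measure_def using \<tau>
    by (subst density_lborel_affine[of _ "sqrt \<tau>" m]) simp_all
qed

section \<open>Mean and covariance\<close>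

theorem theoremA2:
  fixes t0 t1 t \<eta> \<rho> :: real and x0 x1 :: "real^2"
  assumes "t0 < t1" and "\<eta> > 0" and "\<rho> > 0"
    and "t \<in> {t0..t1}" and "t \<noteq> (t0 + t1) / 2"
  defines "m \<equiv> interp_mean t0 t1 x0 x1 t"
    and "\<tau> \<equiv> interp_var t0 t1 \<eta> \<rho> t"
    and "a \<equiv> shift_vec t0 t1 x0 x1 \<eta> \<rho> t"
    and "J \<equiv> jump_measure t0 t1 x0 x1 \<eta> \<rho> t"
    and "s \<equiv> sgn (t0 + t1 - 2 * t)"
  defines "D \<equiv> radial_D s a"
    and "N1 \<equiv> radial_N1 s a"
    and "N11 \<equiv> radial_N11 s a"
    and "Nr2 \<equiv> radial_Nr2 s a"
  shows "prob_space J \<and> integrable J (\<lambda>y. (norm y)\<^sup>2) \<and>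
    mean_vec J = m + (sqrt \<tau> * (N1 / D)) *\<^sub>R ((1 / norm a) *\<^sub>R a) \<and>
    cov_mat J =
      (\<tau> * ((2 * N11 - Nr2) / D - N1\<^sup>2 / D\<^sup>2)) *\<^sub>R ((1 / (norm a)\<^sup>2) *\<^sub>R outer a a)
      + (\<tau> * ((Nr2 - N11) / D)) *\<^sub>R mat 1"
proof -
  have \<tau>: "\<tau> > 0" unfolding \<tau>_def by (rule interp_var_pos[OF assms(1,3,4)])
  have s: "\<bar>s\<bar> = 1" using assms(5) by (auto simp: s_def abs_sgn_eq)
  then have s1: "\<bar>s\<bar> \<le> 1" by simp
  \<comment> \<open>the direction of \<open>a\<close>; if \<open>a = 0\<close>, an arbitrary unit vector\<close>
  define e where "e = (if a = 0 then axis 1 1 else (1 / norm a) *\<^sub>R a)"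
  have e: "norm e = 1" "a = norm a *\<^sub>R e" by (auto simp: e_def)
  let ?p = "perp e"
  note hb = weight_moments[OF e s1, folded D_def N1_def N11_def Nr2_def]
  have D: "integral\<^sup>L lborel (jump_weight s a) = D" using hb(1) by (rule has_bochner_integral_integral_eq)
  have Dpos: "D > 0" using integral_weight_pos[OF s, of a] by (simp add: D)

  define Q where "Q = density lborel (\<lambda>z. ennreal (jump_weight s a z / D))"
  let ?T = "\<lambda>z. m + sqrt \<tau> *\<^sub>R z"
  have J: "J = distr Q borel ?T"
    using jump_measure_standardized[OF assms(1,2) \<tau>[unfolded \<tau>_def] assms(5), of x0 x1]
    unfolding J_def[symmetric] \<tau>_def[symmetric] m_def[symmetric] a_def[symmetric] s_def[symmetric] D Q_def .
  have T [measurable]: "?T \<in> borel_measurable Q" by (simp add: Q_def)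
  have QE: "has_bochner_integral Q g (I /\<^sub>R D)"
    if "has_bochner_integral lborel (\<lambda>z. jump_weight s a z *\<^sub>R g z) I" "g \<in> borel_measurable borel"
    for g :: "real^2 \<Rightarrow> 'b::{banach, second_countable_topology}" and I
    unfolding Q_def
    using has_bochner_integral_scaleR_right[OF that(1), of "1 / D"] that(2) Dpos
    by (intro has_bochner_integral_density) (simp_all add: weight_nonneg divide_inverse_commute)
  have QE': "has_bochner_integral Q g (I / D)"
    if "has_bochner_integral lborel (\<lambda>z. jump_weight s a z * g z) I" "g \<in> borel_measurable borel"
    for g :: "real^2 \<Rightarrow> real" and I
    using QE[of g I] that by (simp add: divide_inverse_commute)
  have M0: "has_bochner_integral Q (\<lambda>_. 1) (1::real)"
    using QE'[of "\<lambda>_. 1" D] hb(1) Dpos by simp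
  have M: "has_bochner_integral Q (\<lambda>z. z \<bullet> e) (N1 / D)"
    "has_bochner_integral Q (\<lambda>z. z \<bullet> ?p) 0"
    "has_bochner_integral Q (\<lambda>z. (z \<bullet> e)\<^sup>2) (N11 / D)"
    "has_bochner_integral Q (\<lambda>z. (z \<bullet> e) * (z \<bullet> ?p)) 0"
    "has_bochner_integral Q (\<lambda>z. (z \<bullet> ?p)\<^sup>2) ((Nr2 - N11) / D)"
    using QE'[OF hb(2)] QE'[OF hb(3)] QE'[OF hb(4)] QE'[OF hb(5)] QE'[OF hb(6)] by simp_all

  have "prob_space Q"
  proof (rule prob_spaceI)
    have "emeasure Q (space Q) = (\<integral>\<^sup>+ z. ennreal 1 \<partial>Q)" by simp
    also have "\<dots> = ennreal 1"
      using M0 by (subst nn_integral_eq_integral) (auto simp: has_bochner_integral_iff simp del: ennreal_1)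
    finally show "emeasure Q (space Q) = 1" by simp
  qed
  then interpret Q: prob_space Q .
  have prob: "prob_space J" unfolding J by (rule Q.prob_space_distr[OF T])

  have M2: "integrable Q (\<lambda>z. (norm z)\<^sup>2)"
    unfolding norm_frame[OF e(1)] using M(3,5) by (simp add: has_bochner_integral_iff)
  have "integrable Q (\<lambda>z. (norm (?T z))\<^sup>2)"
  proof (rule Bochner_Integration.integrable_bound)
    show "integrable Q (\<lambda>z. 2 * (norm m)\<^sup>2 + 2 * \<tau> * (norm z)\<^sup>2)"
      using M2 by simp
    have "(norm (?T z))\<^sup>2 \<le> 2 * (norm m)\<^sup>2 + 2 * \<tau> * (norm z)\<^sup>2" for z
    proof -
      \<comment> \<open>parallelogram law\<close>
      have "(norm (?T z))\<^sup>2 + (norm (m - sqrt \<tau> *\<^sub>R z))\<^sup>2 = 2 * (norm m)\<^sup>2 + 2 * (norm (sqrt \<tau> *\<^sub>R z))\<^sup>2"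
        unfolding power2_norm_eq_inner
        by (simp only: inner_left_distrib inner_right_distrib inner_diff_left inner_diff_right)
      moreover have "(norm (sqrt \<tau> *\<^sub>R z))\<^sup>2 = \<tau> * (norm z)\<^sup>2"
        using \<tau> by (simp add: power_mult_distrib)
      ultimately show ?thesis using zero_le_power2[of "norm (m - sqrt \<tau> *\<^sub>R z)"] by linarith
    qed
    then show "AE z in Q. norm ((norm (?T z))\<^sup>2) \<le> norm (2 * (norm m)\<^sup>2 + 2 * \<tau> * (norm z)\<^sup>2)"
      using \<tau> by simp
  qed simp
  then have int: "integrable J (\<lambda>y. (norm y)\<^sup>2)"
    unfolding J by (subst integrable_distr_eq[OF T]) simp_all

  have "has_bochner_integral Q (\<lambda>z. (z \<bullet> e) *\<^sub>R e + (z \<bullet> ?p) *\<^sub>R ?p) ((N1 / D) *\<^sub>R e + 0 *\<^sub>R ?p)"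
    by (intro has_bochner_integral_add has_bochner_integral_scaleR_left M)
  then have "has_bochner_integral Q (\<lambda>z. z) ((N1 / D) *\<^sub>R e)"
    by (simp add: frame_expansion[OF e(1)])
  moreover have "has_bochner_integral Q (\<lambda>_. m) m"
    using has_bochner_integral_scaleR_left[of m Q "\<lambda>_. 1" 1] M0 by simp
  ultimately have "has_bochner_integral Q ?T (m + sqrt \<tau> *\<^sub>R (N1 / D) *\<^sub>R e)"
    by (intro has_bochner_integral_add has_bochner_integral_scaleR_right)
  then have mean: "mean_vec J = m + (sqrt \<tau> * (N1 / D)) *\<^sub>R e"
    unfolding mean_vec_def J
    by (subst integral_distr[OF T]) (simp_all add: has_bochner_integral_iff)

  have cov: "cov_mat J $ i $ j
      = \<tau> * ((N11 / D - (N1 / D)\<^sup>2) * (e $ i * e $ j) + (Nr2 - N11) / D * (?p $ i * ?p $ j))" for i j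
  proof -
    define c where "c = N1 / D"
    \<comment> \<open>the product of two centred components, linear in the moments \<open>w, u, v, uu, uv, vv\<close> of the
      frame coordinates \<open>u = z \<bullet> e\<close> and \<open>v = z \<bullet> perp e\<close>\<close>
    let ?poly = "\<lambda>w u v uu uv vv. \<tau> * (c\<^sup>2 * e $ i * e $ j * w - 2 * c * e $ i * e $ j * u
      - c * (e $ i * ?p $ j + ?p $ i * e $ j) * v + e $ i * e $ j * uu
      + (e $ i * ?p $ j + ?p $ i * e $ j) * uv + ?p $ i * ?p $ j * vv)"
    have comp: "z $ k = (z \<bullet> e) * e $ k + (z \<bullet> ?p) * ?p $ k" for z k
      using arg_cong[OF frame_expansion[OF e(1), of z], of "\<lambda>v. v $ k"] by simp
    have centred: "?T z $ k - mean_vec J $ k = sqrt \<tau> * ((z \<bullet> e - c) * e $ k + (z \<bullet> ?p) * ?p $ k)" for z k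
      unfolding mean c_def[symmetric] using comp[of z k] by (simp add: algebra_simps)
    have "(?T z $ i - mean_vec J $ i) * (?T z $ j - mean_vec J $ j)
        = ?poly 1 (z \<bullet> e) (z \<bullet> ?p) ((z \<bullet> e)\<^sup>2) ((z \<bullet> e) * (z \<bullet> ?p)) ((z \<bullet> ?p)\<^sup>2)" for z
    proof -
      have "(?T z $ i - mean_vec J $ i) * (?T z $ j - mean_vec J $ j)
        = (sqrt \<tau>)\<^sup>2 * (((z \<bullet> e - c) * e $ i + (z \<bullet> ?p) * ?p $ i) * ((z \<bullet> e - c) * e $ j + (z \<bullet> ?p) * ?p $ j))"
        unfolding centred by (simp only: power2_eq_square mult_ac)
      also have "(sqrt \<tau>)\<^sup>2 = \<tau>" using \<tau> by simp
      finally show ?thesis by (simp add: power2_eq_square algebra_simps)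
    qed
    moreover have "has_bochner_integral Q
        (\<lambda>z. ?poly 1 (z \<bullet> e) (z \<bullet> ?p) ((z \<bullet> e)\<^sup>2) ((z \<bullet> e) * (z \<bullet> ?p)) ((z \<bullet> ?p)\<^sup>2))
        (?poly 1 (N1 / D) 0 (N11 / D) 0 ((Nr2 - N11) / D))"
      by (intro has_bochner_integral_mult_right has_bochner_integral_add has_bochner_integral_diff M M0)
    ultimately have "has_bochner_integral Q (\<lambda>z. (?T z $ i - mean_vec J $ i) * (?T z $ j - mean_vec J $ j))
        (?poly 1 (N1 / D) 0 (N11 / D) 0 ((Nr2 - N11) / D))"
      by (simp only:)
    then have "(\<integral>z. (?T z $ i - mean_vec J $ i) * (?T z $ j - mean_vec J $ j) \<partial>Q)
        = ?poly 1 (N1 / D) 0 (N11 / D) 0 ((Nr2 - N11) / D)"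
      by (rule has_bochner_integral_integral_eq)
    moreover have "cov_mat J $ i $ j = (\<integral>z. (?T z $ i - mean_vec J $ i) * (?T z $ j - mean_vec J $ j) \<partial>Q)"
    proof -
      have "cov_mat J $ i $ j = (\<integral>y. (y $ i - mean_vec J $ i) * (y $ j - mean_vec J $ j) \<partial>J)"
        by (simp add: cov_mat_def)
      also have "\<dots> = (\<integral>y. (y $ i - mean_vec J $ i) * (y $ j - mean_vec J $ j) \<partial>distr Q borel ?T)"
        by (simp only: J)
      also have "\<dots> = (\<integral>z. (?T z $ i - mean_vec J $ i) * (?T z $ j - mean_vec J $ j) \<partial>Q)"
        by (rule integral_distr[OF T]) simp
      finally show ?thesis .
    qed
    ultimately show ?thesis by (simp add: c_def[symmetric] power2_eq_square algebra_simps)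
  qed
  \<comment> \<open>completeness of the frame eliminates \<open>perp e\<close>\<close>
  have pp: "?p $ i * ?p $ j = mat 1 $ i $ j - e $ i * e $ j" for i j
    using unit_real2[OF e(1)] exhaust_2[of i] exhaust_2[of j]
    by (auto simp: mat_def power2_eq_square)
  have cov': "cov_mat J = (\<tau> * ((2 * N11 - Nr2) / D - N1\<^sup>2 / D\<^sup>2)) *\<^sub>R outer e e
      + (\<tau> * ((Nr2 - N11) / D)) *\<^sub>R mat 1"
    unfolding vec_eq_iff
  proof (intro allI)
    fix i j
    show "cov_mat J $ i $ j = ((\<tau> * ((2 * N11 - Nr2) / D - N1\<^sup>2 / D\<^sup>2)) *\<^sub>R outer e e
      + (\<tau> * ((Nr2 - N11) / D)) *\<^sub>R mat 1) $ i $ j"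
      unfolding cov pp by (simp add: outer_def power_divide diff_divide_distrib algebra_simps)
  qed
  show ?thesis
  proof (cases "a = 0")
    case True
    then have "N1 = 0" "2 * N11 - Nr2 = 0"
      using radial_zero_shift[of s] by (simp_all add: N1_def N11_def Nr2_def)
    with True show ?thesis using prob int mean cov' by simp
  next
    case False
    then have "e = (1 / norm a) *\<^sub>R a" by (simp add: e_def)
    moreover from this have "outer e e = (1 / (norm a)\<^sup>2) *\<^sub>R outer a a"
      by (simp add: outer_def vec_eq_iff power2_eq_square)
    ultimately show ?thesis using prob int mean cov' by simp
  qed
qed

end
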